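(* Consider the spin-boson potentials $V_0(x)=\frac12\omega^2|x|^2+c\cdot x$ and $V_1(x)=\frac12\omega^2|x|^2-c\cdot x$ on $\mathbb{R}^d$, with $\omega>0$ and $c\in\mathbb{R}^d$, $c\neq 0$. Let $z_0=(q_0,p_0)\in\mathbb{R}^{2d}$ and let $t_1$ be a time such that $V_0(Q(t_1,z_0))=V_1(Q(t_1,z_0))$. Then for every time $t$ with $0<\omega(t-t_1)<\pi$, $$\partial_{t_1}Q(t,t_1,z_0)\neq 0 .$$
   Context: $Q(\tau,z_0)$ denotes the position at time $\tau$ of the solution of $\frac{d}{d\tau}Q=P$, $\frac{d}{d\tau}P=-\nabla V_0(Q)$ with $(Q,P)=(q_0,p_0)$ at $\tau=0$. For a hopping time $s\in(0,t)$, $Q(t,s,z_0)$ denotes the position at time $t$ of the continuous trajectory with $(Q,P)=(q_0,p_0)$ at $\tau=0$ that solves $\frac{d}{d\tau}Q=P$, $\frac{d}{d\tau}P=-\nabla V_0(Q)$ for $\tau\in[0,s]$ and $\frac{d}{d\tau}Q=P$, $\frac{d}{d\tau}P=-\nabla V_1(Q)$ for $\tau\in[s,t]$. The notation $\partial_{t_1}Q(t,t_1,z_0)$ means the derivative of $Q(t,s,z_0)$ with respect to $s$ at $s=t_1$. *)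

theory Defs
  imports "HOL-Analysis.Analysis"
begin

definition grad :: "(real ^ 'd \<Rightarrow> real) \<Rightarrow> real ^ 'd \<Rightarrow> real ^ 'd" where
  "grad V x = (THE g. GDERIV V x :> g)"

text \<open>At the endpoints of an interval \<open>I\<close> the derivatives are one-sided; in particular
  \<open>Q\<close> and \<open>P\<close> are continuous on \<open>I\<close>.\<close>

definition solves_newton ::
  "(real ^ 'd \<Rightarrow> real) \<Rightarrow> real set \<Rightarrow> (real \<Rightarrow> real ^ 'd) \<Rightarrow> (real \<Rightarrow> real ^ 'd) \<Rightarrow> bool" where
  "solves_newton V I Q P \<longleftrightarrow>
     (\<forall>\<tau>\<in>I. (Q has_vector_derivative P \<tau>) (at \<tau> within I) \<and>
            (P has_vector_derivative - grad V (Q \<tau>)) (at \<tau> within I))"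

text \<open>The segment from \<open>0\<close> to \<open>\<tau>\<close> covers both signs of \<open>\<tau>\<close>.\<close>

definition position ::
  "(real ^ 'd \<Rightarrow> real) \<Rightarrow> real \<Rightarrow> (real ^ 'd) \<times> (real ^ 'd) \<Rightarrow> real ^ 'd" where
  "position V \<tau> z0 =
     (THE x. \<exists>Q P. (Q 0, P 0) = z0 \<and> solves_newton V (closed_segment 0 \<tau>) Q P \<and> Q \<tau> = x)"

text \<open>A trajectory moving under \<open>V0\<close> up to the hopping time \<open>s\<close> and under \<open>V1\<close> afterwards. That
  \<open>Q\<close> and \<open>P\<close> are single functions solving the respective system on both closed intervals makes
  position and momentum continuous at \<open>s\<close>. Meaningful for \<open>0 < s < t\<close>.\<close>

definition hop_position ::
  "(real ^ 'd \<Rightarrow> real) \<Rightarrow> (real ^ 'd \<Rightarrow> real) \<Rightarrow> real \<Rightarrow> real \<Rightarrow>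
     (real ^ 'd) \<times> (real ^ 'd) \<Rightarrow> real ^ 'd" where
  "hop_position V0 V1 t s z0 =
     (THE x. \<exists>Q P. (Q 0, P 0) = z0 \<and> solves_newton V0 {0..s} Q P \<and>
                   solves_newton V1 {s..t} Q P \<and> Q t = x)"

definition spin_boson_V0 :: "real \<Rightarrow> real ^ 'd \<Rightarrow> real ^ 'd \<Rightarrow> real" where
  "spin_boson_V0 \<omega> c x = 1 / 2 * \<omega>\<^sup>2 * (norm x)\<^sup>2 + c \<bullet> x"

definition spin_boson_V1 :: "real \<Rightarrow> real ^ 'd \<Rightarrow> real ^ 'd \<Rightarrow> real" where
  "spin_boson_V1 \<omega> c x = 1 / 2 * \<omega>\<^sup>2 * (norm x)\<^sup>2 - c \<bullet> x"

end

theory Submission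
  imports Defs
begin

text \<open>Both potentials are quadratic, so both flows are harmonic oscillations about the centres
  \<open>-c/\<omega>\<^sup>2\<close> and \<open>c/\<omega>\<^sup>2\<close>. Differentiating the composed flow in the hopping time \<open>s\<close>, everything
  cancels except the jump \<open>-2c\<close> of the force, propagated by the second oscillator from \<open>s\<close> to \<open>t\<close>:
  the derivative is \<open>-(2 sin(\<omega>(t - s))/\<omega>) c\<close>.\<close>

text \<open>The flow of the oscillator with force
  \<open>- \<omega>\<^sup>2 *\<^sub>R (x - a)\<close>, in closed form; \<tau> is the time elapsed
  since the state \<open>(q, p)\<close>.\<close>

definition osc_position ::
  "real \<Rightarrow> 'a::real_normed_vector \<Rightarrow> 'a \<Rightarrow> 'a \<Rightarrow> real \<Rightarrow> 'a" where
  "osc_position \<omega> a q p \<tau> = a + cos (\<omega> * \<tau>) *\<^sub>R (q - a) + (sin (\<omega> * \<tau>) / \<omega>) *\<^sub>R p"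

definition osc_momentum ::
  "real \<Rightarrow> 'a::real_normed_vector \<Rightarrow> 'a \<Rightarrow> 'a \<Rightarrow> real \<Rightarrow> 'a" where
  "osc_momentum \<omega> a q p \<tau> = cos (\<omega> * \<tau>) *\<^sub>R p - (\<omega> * sin (\<omega> * \<tau>)) *\<^sub>R (q - a)"

lemma osc_position_0 [simp]: "osc_position \<omega> a q p 0 = q"
  by (simp add: osc_position_def)

lemma osc_momentum_0 [simp]: "osc_momentum \<omega> a q p 0 = p"
  by (simp add: osc_momentum_def)

text \<open>The shift \<open>u\<close> is the starting time of a leg of the trajectory, and an
  arbitrary \<open>S\<close> covers the one-sided derivatives at its ends.\<close>

lemma has_vector_derivative_osc_position:
  assumes "\<omega> \<noteq> 0"
  shows "((\<lambda>\<tau>. osc_position \<omega> a q p (\<tau> - u)) has_vector_derivative osc_momentum \<omega> a q p (\<tau> - u))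
           (at \<tau> within S)"
  unfolding osc_position_def osc_momentum_def using assms
  by (auto intro!: derivative_eq_intros simp: scaleR_right_distrib)

lemma has_vector_derivative_osc_momentum:
  assumes "\<omega> \<noteq> 0"
  shows "((\<lambda>\<tau>. osc_momentum \<omega> a q p (\<tau> - u)) has_vector_derivative
             - (\<omega>\<^sup>2 *\<^sub>R (osc_position \<omega> a q p (\<tau> - u) - a))) (at \<tau> within S)"
  unfolding osc_position_def osc_momentum_def using assms
  by (auto intro!: derivative_eq_intros simp: power2_eq_square algebra_simps)

text \<open>Uniqueness of the derivative resolves the description in \<open>grad\<close>.\<close>

lemma GDERIV_imp_grad:
  assumes "GDERIV V x :> g"
  shows "grad V x = g"
  unfolding grad_def
proof (rule the_equality)
  fix h assume "GDERIV V x :> h"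
  then have "(\<lambda>y. y \<bullet> h) = (\<lambda>y. y \<bullet> g)"
    using assms unfolding gderiv_def by (rule has_derivative_unique)
  then show "h = g"
    by (simp add: fun_eq_iff vector_eq_ldot)
qed (rule assms)

text \<open>Completing the square puts the gradient into the centred form that the oscillator lemmas
  expect.\<close>

lemma grad_spin_boson_V0:
  assumes "\<omega> \<noteq> 0"
  shows "grad (spin_boson_V0 \<omega> c) x = \<omega>\<^sup>2 *\<^sub>R (x - (- (1 / \<omega>\<^sup>2) *\<^sub>R c))"
proof (rule GDERIV_imp_grad)
  show "GDERIV (spin_boson_V0 \<omega> c) x :> \<omega>\<^sup>2 *\<^sub>R (x - (- (1 / \<omega>\<^sup>2) *\<^sub>R c))"
    unfolding gderiv_def spin_boson_V0_def power2_norm_eq_inner using assms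
    by (auto intro!: derivative_eq_intros simp: inner_commute algebra_simps)
qed

lemma spin_boson_V1_eq: "spin_boson_V1 \<omega> c = spin_boson_V0 \<omega> (- c)"
  by (auto simp: spin_boson_V0_def spin_boson_V1_def)

lemma grad_spin_boson_V1:
  assumes "\<omega> \<noteq> 0"
  shows "grad (spin_boson_V1 \<omega> c) x = \<omega>\<^sup>2 *\<^sub>R (x - (1 / \<omega>\<^sup>2) *\<^sub>R c)"
  by (simp add: spin_boson_V1_eq grad_spin_boson_V0[OF assms])

text \<open>Only values on \<open>I\<close> matter, so each leg of a trajectory defined by cases can
  be checked separately.\<close>

lemma solves_newton_cong:
  assumes "solves_newton V I Q P"
    and "\<And>\<tau>. \<tau> \<in> I \<Longrightarrow> Q' \<tau> = Q \<tau>" and "\<And>\<tau>. \<tau> \<in> I \<Longrightarrow> P' \<tau> = P \<tau>"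
  shows "solves_newton V I Q' P'"
  unfolding solves_newton_def
proof (intro ballI conjI)
  fix \<tau> assume \<tau>: "\<tau> \<in> I"
  show "(Q' has_vector_derivative P' \<tau>) (at \<tau> within I)"
    using assms \<tau> unfolding solves_newton_def by (auto intro: has_vector_derivative_transform)
  show "(P' has_vector_derivative - grad V (Q' \<tau>)) (at \<tau> within I)"
    using assms \<tau> unfolding solves_newton_def by (auto intro: has_vector_derivative_transform)
qed

lemma solves_newton_osc:
  assumes "\<omega> \<noteq> 0" and "\<And>x. grad V x = \<omega>\<^sup>2 *\<^sub>R (x - a)"
  shows "solves_newton V I (\<lambda>\<tau>. osc_position \<omega> a q p (\<tau> - u)) (\<lambda>\<tau>. osc_momentum \<omega> a q p (\<tau> - u))"
  unfolding solves_newton_def assms(2)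
  using has_vector_derivative_osc_position[OF assms(1)]
    has_vector_derivative_osc_momentum[OF assms(1)] by blast

text \<open>Flowing the state at time \<open>\<tau>\<close> on to the fixed final time \<open>v\<close> gives a function of \<open>\<tau>\<close> with zero
  derivative, which replaces the general uniqueness theorem for ODEs.\<close>

lemma solves_newton_osc_unique:
  assumes "\<omega> \<noteq> 0" and "\<And>x. grad V x = \<omega>\<^sup>2 *\<^sub>R (x - a)"
    and "solves_newton V {u..v} Q P" and "u \<le> v"
  shows "Q v = osc_position \<omega> a (Q u) (P u) (v - u)" and "P v = osc_momentum \<omega> a (Q u) (P u) (v - u)"
proof -
  have Q: "(Q has_vector_derivative P \<tau>) (at \<tau> within {u..v})"
    and P: "(P has_vector_derivative - (\<omega>\<^sup>2 *\<^sub>R (Q \<tau> - a))) (at \<tau> within {u..v})"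
    if "\<tau> \<in> {u..v}" for \<tau>
    using assms(2,3) that unfolding solves_newton_def by auto
  have dQ: "((\<lambda>\<tau>. osc_position \<omega> a (Q \<tau>) (P \<tau>) (v - \<tau>)) has_vector_derivative 0) (at \<tau> within {u..v})"
    if "\<tau> \<in> {u..v}" for \<tau>
    unfolding osc_position_def using assms(1)
    by (auto intro!: derivative_eq_intros Q[OF that] P[OF that]
        simp: power2_eq_square algebra_simps)
  have "osc_position \<omega> a (Q v) (P v) (v - v) = osc_position \<omega> a (Q u) (P u) (v - u)"
    using \<open>u \<le> v\<close> has_vector_derivative_zero_constant[OF convex_real_interval(5) dQ]
    by (metis atLeastAtMost_iff order_refl)
  then show "Q v = osc_position \<omega> a (Q u) (P u) (v - u)"
    by simp
  have dP: "((\<lambda>\<tau>. osc_momentum \<omega> a (Q \<tau>) (P \<tau>) (v - \<tau>)) has_vector_derivative 0) (at \<tau> within {u..v})"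
    if "\<tau> \<in> {u..v}" for \<tau>
    unfolding osc_momentum_def using assms(1)
    by (auto intro!: derivative_eq_intros Q[OF that] P[OF that]
        simp: power2_eq_square algebra_simps)
  have "osc_momentum \<omega> a (Q v) (P v) (v - v) = osc_momentum \<omega> a (Q u) (P u) (v - u)"
    using \<open>u \<le> v\<close> has_vector_derivative_zero_constant[OF convex_real_interval(5) dP]
    by (metis atLeastAtMost_iff order_refl)
  then show "P v = osc_momentum \<omega> a (Q u) (P u) (v - u)"
    by simp
qed

text \<open>Gluing two oscillations gives existence and uniqueness on each leg gives uniqueness, so
  the description in \<open>hop_position\<close> denotes the composed flow.\<close>

lemma hop_position_osc:
  assumes "\<omega> \<noteq> 0" and "\<And>x. grad V0 x = \<omega>\<^sup>2 *\<^sub>R (x - a)" and "\<And>x. grad V1 x = \<omega>\<^sup>2 *\<^sub>R (x - b)"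
    and "0 < s" and "s < t"
  shows "hop_position V0 V1 t s (q, p) =
    osc_position \<omega> b (osc_position \<omega> a q p s) (osc_momentum \<omega> a q p s) (t - s)"
  unfolding hop_position_def
proof (rule the_equality)
  let ?q = "osc_position \<omega> a q p s" and ?p = "osc_momentum \<omega> a q p s"
  \<comment> \<open>At \<open>\<tau> = s\<close> both branches give \<open>?q\<close>, and likewise
    \<open>?p\<close> for the momentum, so the second leg also holds at its left end.\<close>
  define Q where "Q \<tau> = (if \<tau> \<le> s then osc_position \<omega> a q p \<tau> else osc_position \<omega> b ?q ?p (\<tau> - s))" for \<tau>
  define P where "P \<tau> = (if \<tau> \<le> s then osc_momentum \<omega> a q p \<tau> else osc_momentum \<omega> b ?q ?p (\<tau> - s))" for \<tau>
  have "solves_newton V0 {0..s} Q P"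
    by (rule solves_newton_cong[OF solves_newton_osc[OF assms(1,2), of _ q p 0]])
      (auto simp: Q_def P_def)
  moreover have "solves_newton V1 {s..t} Q P"
    by (rule solves_newton_cong[OF solves_newton_osc[OF assms(1,3), of _ ?q ?p s]])
      (auto simp: Q_def P_def)
  moreover have "(Q 0, P 0) = (q, p)" "Q t = osc_position \<omega> b ?q ?p (t - s)"
    using assms(4,5) by (auto simp: Q_def P_def)
  ultimately show "\<exists>Q P. (Q 0, P 0) = (q, p) \<and> solves_newton V0 {0..s} Q P \<and>
      solves_newton V1 {s..t} Q P \<and> Q t = osc_position \<omega> b ?q ?p (t - s)"
    by blast
next
  fix x
  assume "\<exists>Q P. (Q 0, P 0) = (q, p) \<and> solves_newton V0 {0..s} Q P \<and>
      solves_newton V1 {s..t} Q P \<and> Q t = x"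
  then obtain Q P where "Q 0 = q" "P 0 = p" "solves_newton V0 {0..s} Q P"
    "solves_newton V1 {s..t} Q P" "Q t = x"
    by auto
  \<comment> \<open>Uniqueness on the first leg fixes position and momentum at \<open>s\<close>, the
    initial state of the second leg.\<close>
  then show "x = osc_position \<omega> b (osc_position \<omega> a q p s) (osc_momentum \<omega> a q p s) (t - s)"
    using solves_newton_osc_unique[OF assms(1,2), of 0 s Q P]
      solves_newton_osc_unique(1)[OF assms(1,3), of s t Q P] assms(4,5) by simp
qed

text \<open>In the product rule the momentum terms cancel, and the position terms
  \<open>Q - b\<close> and \<open>Q - a\<close> leave only the difference of the centres.\<close>

lemma has_vector_derivative_osc_hop:
  assumes "\<omega> \<noteq> 0"
  shows "((\<lambda>s. osc_position \<omega> b (osc_position \<omega> a q p s) (osc_momentum \<omega> a q p s) (t - s))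
      has_vector_derivative (\<omega> * sin (\<omega> * (t - s))) *\<^sub>R (a - b)) (at s)"
proof -
  note Q = has_vector_derivative_osc_position[OF assms, of a q p 0, simplified]
  note P = has_vector_derivative_osc_momentum[OF assms, of a q p 0, simplified]
  show ?thesis
    \<comment> \<open>Only the outer flow is unfolded; the inner position and momentum are
      differentiated through \<open>Q\<close> and \<open>P\<close>.\<close>
    unfolding osc_position_def[of \<omega> b] using assms
    by (auto intro!: derivative_eq_intros Q P simp: power2_eq_square algebra_simps)
qed

theorem lemmaA1:
  fixes \<omega> t t1 :: real and c q0 p0 :: "real ^ 'd" and V0 V1 :: "real ^ 'd \<Rightarrow> real"
  defines "V0 \<equiv> spin_boson_V0 \<omega> c" and "V1 \<equiv> spin_boson_V1 \<omega> c"
  assumes "\<omega> > 0" and "c \<noteq> 0" and "t1 > 0"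
    and "V0 (position V0 t1 (q0, p0)) = V1 (position V0 t1 (q0, p0))"
    and "0 < \<omega> * (t - t1)" and "\<omega> * (t - t1) < pi"
  shows "\<exists>D. ((\<lambda>s. hop_position V0 V1 t s (q0, p0)) has_vector_derivative D) (at t1) \<and> D \<noteq> 0"
proof -
  let ?a = "- (1 / \<omega>\<^sup>2) *\<^sub>R c" and ?b = "(1 / \<omega>\<^sup>2) *\<^sub>R c"
  let ?D = "(\<omega> * sin (\<omega> * (t - t1))) *\<^sub>R (?a - ?b)"
  have \<omega>: "\<omega> \<noteq> 0"
    using \<open>\<omega> > 0\<close> by simp
  \<comment> \<open>The closed form is available for \<open>0 < s < t\<close>; this open interval
    around \<open>t1\<close> suffices for the derivative there.\<close>
  have "t1 \<in> {0<..<t}"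
    using \<open>0 < \<omega> * (t - t1)\<close> \<open>\<omega> > 0\<close> \<open>t1 > 0\<close> by (simp add: zero_less_mult_iff)
  then have "((\<lambda>s. hop_position V0 V1 t s (q0, p0)) has_vector_derivative ?D) (at t1)"
    by (rule has_vector_derivative_transform_within_open[OF has_vector_derivative_osc_hop[OF \<omega>]
          open_greaterThanLessThan])
      (simp add: V0_def V1_def
        hop_position_osc[OF \<omega> grad_spin_boson_V0[OF \<omega>] grad_spin_boson_V1[OF \<omega>]])
  moreover have "sin (\<omega> * (t - t1)) > 0"
    using assms by (intro sin_gt_zero)
  \<comment> \<open>The centres differ by \<open>- (2 / \<omega>\<^sup>2) *\<^sub>R c\<close>, so
    \<open>?D\<close> is a nonzero multiple of \<open>c\<close>.\<close>
  then have "?D \<noteq> 0"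
    using \<omega> \<open>c \<noteq> 0\<close> by (simp flip: scaleR_left_distrib scaleR_minus_left scaleR_left_diff_distrib)
  ultimately show ?thesis
    by blast
qed

end
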